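(* Let $I=[0,a]$ or $I=[0,\infty)$ and let $f:I\to\mathbb{R}$ be superquadratic. Let $k,n_1,\dots,n_k$ be positive integers. For $i=1,\dots,k$ let $\mathbf{p}_i=(p_{i1},\dots,p_{in_i})$ and $\mathbf{r}_i=(r_{i1},\dots,r_{in_i})$ have positive real entries with $\sum_{j=1}^{n_i}p_{ij}=1$ and $\sum_{j=1}^{n_i}r_{ij}=1$, and let $\mathbf{x}_i=(x_{i1},\dots,x_{in_i})\in I^{n_i}$. Let $\mathbf{q}=(q_1,\dots,q_k)$ with $q_i>0$ and $\sum_{i=1}^k q_i=1$. Put $$m=\min_{1\le j_1\le n_1,\dots,1\le j_k\le n_k}\frac{p_{1j_1}\cdots p_{kj_k}}{r_{1j_1}\cdots r_{kj_k}},\qquad M=\max_{1\le j_1\le n_1,\dots,1\le j_k\le n_k}\frac{p_{1j_1}\cdots p_{kj_k}}{r_{1j_1}\cdots r_{kj_k}},$$ $$\bar{x}_p=\sum_{i=1}^k q_i\sum_{j=1}^{n_i}p_{ij}x_{ij},\qquad \bar{x}_r=\sum_{i=1}^k q_i\sum_{j=1}^{n_i}r_{ij}x_{ij}.$$ Then $$\mathcal{J}_k(f,\mathbf{p}_1,\dots,\mathbf{p}_k,\mathbf{q},\mathbf{x}_1,\dots,\mathbf{x}_k)-m\,\mathcal{J}_k(f,\mathbf{r}_1,\dots,\mathbf{r}_k,\mathbf{q},\mathbf{x}_1,\dots,\mathbf{x}_k)$$ $$\geq m f\Big(\Big|\sum_{i=1}^k q_i\sum_{j=1}^{n_i}(r_{ij}-p_{ij})x_{ij}\Big|\Big)+\sum_{j_1=1}^{n_1}\cdots\sum_{j_k=1}^{n_k}\big(p_{1j_1}\cdots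 p_{kj_k}-m\,r_{1j_1}\cdots r_{kj_k}\big)f\Big(\Big|\sum_{i=1}^k q_ix_{ij_i}-\bar{x}_p\Big|\Big)$$ and $$M\,\mathcal{J}_k(f,\mathbf{r}_1,\dots,\mathbf{r}_k,\mathbf{q},\mathbf{x}_1,\dots,\mathbf{x}_k)-\mathcal{J}_k(f,\mathbf{p}_1,\dots,\mathbf{p}_k,\mathbf{q},\mathbf{x}_1,\dots,\mathbf{x}_k)$$ $$\geq f\Big(\Big|\sum_{i=1}^k q_i\sum_{j=1}^{n_i}(r_{ij}-p_{ij})x_{ij}\Big|\Big)+\sum_{j_1=1}^{n_1}\cdots\sum_{j_k=1}^{n_k}\big(M\,r_{1j_1}\cdots r_{kj_k}-p_{1j_1}\cdots p_{kj_k}\big)f\Big(\Big|\sum_{i=1}^k q_ix_{ij_i}-\bar{x}_r\Big|\Big).$$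
   Context: A function $f:I\to\mathbb{R}$ on an interval $I=[0,a]$ or $I=[0,\infty)$ is superquadratic if for each $x\in I$ there exists a real number $C(x)$ such that $f(y)-f(x)\geq f(|y-x|)+C(x)(y-x)$ for all $y\in I$. The generalized Jensen functional is defined, for weight vectors $\mathbf{p}_i=(p_{i1},\dots,p_{in_i})$ with positive entries summing to $1$, points $\mathbf{x}_i\in I^{n_i}$ ($i=1,\dots,k$), and $\mathbf{q}=(q_1,\dots,q_k)$ with positive entries summing to $1$, by $$\mathcal{J}_k(f,\mathbf{p}_1,\dots,\mathbf{p}_k,\mathbf{q},\mathbf{x}_1,\dots,\mathbf{x}_k)=\sum_{j_1=1}^{n_1}\cdots\sum_{j_k=1}^{n_k}p_{1j_1}\cdots p_{kj_k}\,f\Big(\sum_{i=1}^k q_ix_{ij_i}\Big)-f\Big(\sum_{i=1}^k q_i\sum_{j=1}^{n_i}p_{ij}x_{ij}\Big).$$ *)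

theory Defs
  imports Complex_Main "HOL-Library.FuncSet"
begin

definition superquadratic_on :: "real set \<Rightarrow> (real \<Rightarrow> real) \<Rightarrow> bool" where
  "superquadratic_on I f \<longleftrightarrow>
     (\<forall>x\<in>I. \<exists>C. \<forall>y\<in>I. f y - f x \<ge> f \<bar>y - x\<bar> + C * (y - x))"

text \<open>The multi-indices \<open>(j\<^sub>1, \<dots>, j\<^sub>k)\<close> with \<open>1 \<le> j\<^sub>i \<le> n\<^sub>i\<close>. A sum over
  \<open>multi_indices k n\<close> stands for the iterated sum over \<open>j\<^sub>1, \<dots>, j\<^sub>k\<close>.\<close>

definition multi_indices :: "nat \<Rightarrow> (nat \<Rightarrow> nat) \<Rightarrow> (nat \<Rightarrow> nat) set" where
  "multi_indices k n = (\<Pi>\<^sub>E i\<in>{1..k}. {1..n i})"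

definition jensen_functional ::
  "nat \<Rightarrow> (nat \<Rightarrow> nat) \<Rightarrow> (real \<Rightarrow> real) \<Rightarrow> (nat \<Rightarrow> nat \<Rightarrow> real) \<Rightarrow>
    (nat \<Rightarrow> real) \<Rightarrow> (nat \<Rightarrow> nat \<Rightarrow> real) \<Rightarrow> real" where
  "jensen_functional k n f p q x =
     (\<Sum>j\<in>multi_indices k n. (\<Prod>i=1..k. p i (j i)) * f (\<Sum>i=1..k. q i * x i (j i)))
     - f (\<Sum>i=1..k. q i * (\<Sum>j=1..n i. p i j * x i j))"

end

theory Submission
  imports Defs "HOL-Analysis.Convex"
begin

text \<open>
  Superquadraticity at a point \<open>z\<close> bounds \<open>f\<close> from below by a line through \<open>(z, f z)\<close> plus
  the remainder \<open>f \<bar>y - z\<bar>\<close>. Summing this bound over finitely many points with nonnegative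
  weights, the unknown slope drops out as soon as the weighted deviations from \<open>z\<close> cancel.

  The nested sums over \<open>j\<^sub>1, \<dots>, j\<^sub>k\<close> form a single finite family of points
  \<open>X j = (\<Sum>i. q i * x i (j i))\<close> with weights \<open>P j = (\<Prod>i. p i (j i))\<close> and \<open>R j = (\<Prod>i. r i (j i))\<close>.
  Distributing a product of sums shows that both weight families are probability distributions
  on the multi-indices whose barycentres are \<open>xp\<close> and \<open>xr\<close>.

  By the choice of \<open>m\<close> and \<open>M\<close>, the weights \<open>P - m R\<close> and \<open>M R - P\<close> are nonnegative. The points
  \<open>X j\<close> with weights \<open>P j - m R j\<close> alone need not be balanced around \<open>xp\<close>, but they are after adding
  the further point \<open>xr\<close> with weight \<open>m\<close>. This extra point contributes both the value \<open>m f xr\<close>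
  needed to complete the functional of \<open>r\<close> and the remainder \<open>m f \<bar>xr - xp\<bar>\<close>. In the same way,
  \<open>M R - P\<close> together with \<open>xp\<close> of weight \<open>1\<close> is balanced around \<open>xr\<close>. Both are instances of
  \<open>superquadratic_barycentre_comparison\<close>, with the weight pairs \<open>(P, m R)\<close> and \<open>(M R, P)\<close>.
\<close>

text \<open>
  The common form of the two estimates: \<open>v\<close> is dominated by \<open>u\<close>, and trading the masses \<open>v j\<close> at
  the points \<open>X j\<close> for one mass at their barycentre \<open>y\<close> keeps the barycentre \<open>z\<close> of \<open>u\<close>.
  The weights are not normalised, so that \<open>m R\<close> and \<open>M R\<close> can be inserted directly.
\<close>

lemma superquadratic_barycentre_comparison:
  fixes f :: "real \<Rightarrow> real" and u v X :: "'a \<Rightarrow> real"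
  assumes f: "superquadratic_on I f"
    and X: "\<And>j. j \<in> J \<Longrightarrow> X j \<in> I"
    and dom: "\<And>j. j \<in> J \<Longrightarrow> v j \<le> u j"
    and sum_u: "sum u J = s" and sum_v: "sum v J = t" and t: "t \<ge> 0"
    and z: "(\<Sum>j\<in>J. u j * X j) = s * z" "z \<in> I"
    and y: "(\<Sum>j\<in>J. v j * X j) = t * y" "y \<in> I"
  shows "t * f \<bar>y - z\<bar> + (\<Sum>j\<in>J. (u j - v j) * f \<bar>X j - z\<bar>)
    \<le> ((\<Sum>j\<in>J. u j * f (X j)) - s * f z) - ((\<Sum>j\<in>J. v j * f (X j)) - t * f y)"
proof -
  obtain C where C: "\<And>w. w \<in> I \<Longrightarrow> f \<bar>w - z\<bar> \<le> f w - f z - C * (w - z)"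
    using f z(2) unfolding superquadratic_on_def by (metis add_le_cancel_right diff_add_cancel)
  have "(\<Sum>j\<in>J. (u j - v j) * f \<bar>X j - z\<bar>)
      \<le> (\<Sum>j\<in>J. (u j - v j) * (f (X j) - f z - C * (X j - z)))"
    by (intro sum_mono mult_left_mono C X) (use dom in auto)
  also have "\<dots> = (\<Sum>j\<in>J. u j * f (X j)) - (\<Sum>j\<in>J. v j * f (X j)) - (sum u J - sum v J) * f z
      - C * ((\<Sum>j\<in>J. u j * X j) - (\<Sum>j\<in>J. v j * X j) - (sum u J - sum v J) * z)"
    by (simp add: algebra_simps sum.distrib sum_subtractf sum_distrib_left sum_distrib_right)
  also have "\<dots> = (\<Sum>j\<in>J. u j * f (X j)) - (\<Sum>j\<in>J. v j * f (X j)) - (s - t) * f z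
      + t * (C * (y - z))"
    unfolding sum_u sum_v z(1) y(1) by (simp add: algebra_simps)
  \<comment> \<open>The remaining slope term is the one in the bound at \<open>y\<close>, taken with weight \<open>t\<close>.\<close>
  finally show ?thesis
    using mult_left_mono[OF C[OF y(2)] t] by (simp add: algebra_simps)
qed

lemma finite_multi_indices: "finite (multi_indices k n)"
  unfolding multi_indices_def by (intro finite_PiE) auto

lemma multi_indices_nonempty:
  assumes "\<And>i. i \<in> {1..k} \<Longrightarrow> n i \<ge> 1"
  shows "multi_indices k n \<noteq> {}"
  using assms unfolding multi_indices_def by (auto simp: PiE_eq_empty_iff)

lemma multi_indices_mem:
  assumes "j \<in> multi_indices k n" "i \<in> {1..k}"
  shows "j i \<in> {1..n i}"
  using assms unfolding multi_indices_def by (rule PiE_mem)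

lemma sum_multi_indices_prod:
  fixes g :: "nat \<Rightarrow> nat \<Rightarrow> real"
  shows "(\<Sum>j\<in>multi_indices k n. \<Prod>i=1..k. g i (j i)) = (\<Prod>i=1..k. \<Sum>j=1..n i. g i j)"
  unfolding multi_indices_def by (simp add: prod_sum_PiE)

lemma sum_product_weights:
  fixes p :: "nat \<Rightarrow> nat \<Rightarrow> real"
  assumes "\<And>i. i \<in> {1..k} \<Longrightarrow> (\<Sum>j=1..n i. p i j) = 1"
  shows "(\<Sum>j\<in>multi_indices k n. \<Prod>i=1..k. p i (j i)) = 1"
  unfolding sum_multi_indices_prod using assms by simp

text \<open>
  The factor \<open>h (j l)\<close> can be absorbed into the \<open>l\<close>-th factor of the product; after distributing,
  all other factors sum to 1. This is the marginal law of a product distribution, and the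
  barycentre formula below needs it for each coordinate, by linearity.
\<close>

lemma product_weights_marginal:
  fixes p :: "nat \<Rightarrow> nat \<Rightarrow> real" and h :: "nat \<Rightarrow> real"
  assumes p: "\<And>i. i \<in> {1..k} \<Longrightarrow> (\<Sum>j=1..n i. p i j) = 1" and l: "l \<in> {1..k}"
  shows "(\<Sum>j\<in>multi_indices k n. (\<Prod>i=1..k. p i (j i)) * h (j l)) = (\<Sum>j=1..n l. p l j * h j)"
proof -
  have "(\<Prod>i=1..k. p i (j i)) * h (j l)
      = (\<Prod>i=1..k. p i (j i) * (if i = l then h (j i) else 1))" for j :: "nat \<Rightarrow> nat"
    using l by (simp add: prod.distrib prod.delta)
  then have "(\<Sum>j\<in>multi_indices k n. (\<Prod>i=1..k. p i (j i)) * h (j l))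
      = (\<Prod>i=1..k. \<Sum>j=1..n i. p i j * (if i = l then h j else 1))"
    by (simp only: sum_multi_indices_prod[where g = "\<lambda>i j. p i j * (if i = l then h j else 1)"])
  also have "\<dots> = (\<Prod>i=1..k. if i = l then \<Sum>j=1..n l. p l j * h j else 1)"
    by (intro prod.cong) (auto simp: p simp del: One_nat_def)
  also have "\<dots> = (\<Sum>j=1..n l. p l j * h j)"
    using l by (simp add: prod.delta)
  finally show ?thesis .
qed

lemma product_weights_barycentre:
  fixes p x :: "nat \<Rightarrow> nat \<Rightarrow> real" and q :: "nat \<Rightarrow> real"
  assumes "\<And>i. i \<in> {1..k} \<Longrightarrow> (\<Sum>j=1..n i. p i j) = 1"
  shows "(\<Sum>j\<in>multi_indices k n. (\<Prod>i=1..k. p i (j i)) * (\<Sum>i=1..k. q i * x i (j i)))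
    = (\<Sum>i=1..k. q i * (\<Sum>j=1..n i. p i j * x i j))"
proof -
  have "(\<Sum>j\<in>multi_indices k n. (\<Prod>i=1..k. p i (j i)) * (\<Sum>l=1..k. q l * x l (j l)))
      = (\<Sum>l=1..k. q l * (\<Sum>j\<in>multi_indices k n. (\<Prod>i=1..k. p i (j i)) * x l (j l)))"
    by (simp add: sum_distrib_left mult.left_commute) (rule sum.swap)
  also have "\<dots> = (\<Sum>l=1..k. q l * (\<Sum>j=1..n l. p l j * x l j))"
    by (intro sum.cong refl arg_cong2[where f = "(*)"]
        product_weights_marginal[where p = p and n = n and k = k] assms)
  finally show ?thesis .
qed

theorem theorem5:
  fixes I :: "real set" and f :: "real \<Rightarrow> real"
    and k :: nat and n :: "nat \<Rightarrow> nat"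
    and p r x :: "nat \<Rightarrow> nat \<Rightarrow> real" and q :: "nat \<Rightarrow> real"
    and m M xp xr :: real
  assumes I: "I = {0..} \<or> (\<exists>a\<ge>0. I = {0..a})"
    and f: "superquadratic_on I f"
    and k: "k \<ge> 1"
    and n: "\<And>i. i \<in> {1..k} \<Longrightarrow> n i \<ge> 1"
    and p_pos: "\<And>i j. i \<in> {1..k} \<Longrightarrow> j \<in> {1..n i} \<Longrightarrow> p i j > 0"
    and p_sum: "\<And>i. i \<in> {1..k} \<Longrightarrow> (\<Sum>j=1..n i. p i j) = 1"
    and r_pos: "\<And>i j. i \<in> {1..k} \<Longrightarrow> j \<in> {1..n i} \<Longrightarrow> r i j > 0"
    and r_sum: "\<And>i. i \<in> {1..k} \<Longrightarrow> (\<Sum>j=1..n i. r i j) = 1"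
    and x: "\<And>i j. i \<in> {1..k} \<Longrightarrow> j \<in> {1..n i} \<Longrightarrow> x i j \<in> I"
    and q_pos: "\<And>i. i \<in> {1..k} \<Longrightarrow> q i > 0"
    and q_sum: "(\<Sum>i=1..k. q i) = 1"
    and m: "m = Min ((\<lambda>j. (\<Prod>i=1..k. p i (j i)) / (\<Prod>i=1..k. r i (j i))) ` multi_indices k n)"
    and M: "M = Max ((\<lambda>j. (\<Prod>i=1..k. p i (j i)) / (\<Prod>i=1..k. r i (j i))) ` multi_indices k n)"
    and xp: "xp = (\<Sum>i=1..k. q i * (\<Sum>j=1..n i. p i j * x i j))"
    and xr: "xr = (\<Sum>i=1..k. q i * (\<Sum>j=1..n i. r i j * x i j))"
  shows "(jensen_functional k n f p q x - m * jensen_functional k n f r q x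
      \<ge> m * f \<bar>\<Sum>i=1..k. q i * (\<Sum>j=1..n i. (r i j - p i j) * x i j)\<bar>
        + (\<Sum>j\<in>multi_indices k n.
             ((\<Prod>i=1..k. p i (j i)) - m * (\<Prod>i=1..k. r i (j i)))
             * f \<bar>(\<Sum>i=1..k. q i * x i (j i)) - xp\<bar>))
    \<and> (M * jensen_functional k n f r q x - jensen_functional k n f p q x
      \<ge> f \<bar>\<Sum>i=1..k. q i * (\<Sum>j=1..n i. (r i j - p i j) * x i j)\<bar>
        + (\<Sum>j\<in>multi_indices k n.
             (M * (\<Prod>i=1..k. r i (j i)) - (\<Prod>i=1..k. p i (j i)))
             * f \<bar>(\<Sum>i=1..k. q i * x i (j i)) - xr\<bar>))"
proof -
  define J where "J = multi_indices k n"
  define P where "P = (\<lambda>j :: nat \<Rightarrow> nat. \<Prod>i=1..k. p i (j i))"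
  define R where "R = (\<lambda>j :: nat \<Rightarrow> nat. \<Prod>i=1..k. r i (j i))"
  define X where "X = (\<lambda>j :: nat \<Rightarrow> nat. \<Sum>i=1..k. q i * x i (j i))"
  have fin: "finite J" and nonempty: "J \<noteq> {}"
    using finite_multi_indices multi_indices_nonempty[of k n] n unfolding J_def by auto
  have pos: "P j > 0" "R j > 0" if "j \<in> J" for j
    using multi_indices_mem[of j k n] that
    by (auto simp: P_def R_def J_def intro!: prod_pos p_pos r_pos)

  have m_le: "m * R j \<le> P j" and le_M: "P j \<le> M * R j" if "j \<in> J" for j
  proof -
    have "m \<le> P j / R j" "P j / R j \<le> M"
      unfolding m M P_def R_def using fin that by (auto simp: J_def intro!: Min_le Max_ge)
    then show "m * R j \<le> P j" "P j \<le> M * R j"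
      using pos[OF that] by (simp_all add: field_simps)
  qed
  have m_nonneg: "m \<ge> 0"
  proof -
    have "m \<in> (\<lambda>j. P j / R j) ` J"
      unfolding m P_def R_def J_def[symmetric] using fin nonempty by (intro Min_in) auto
    then show ?thesis
      using pos by (auto intro: less_imp_le)
  qed

  have "convex I"
    using I by auto
  then have mean_mem: "(\<Sum>i=1..k. q i * y i) \<in> I" if "\<And>i. i \<in> {1..k} \<Longrightarrow> y i \<in> I" for y
    using convex_sum[of "{1..k}" I q y] that q_sum q_pos by (auto simp: less_imp_le)
  have X_mem: "X j \<in> I" if "j \<in> J" for j
    unfolding X_def using that multi_indices_mem[of j k n] by (intro mean_mem x) (auto simp: J_def)
  have row_mem: "(\<Sum>j=1..n i. w i j * x i j) \<in> I"
    if "i \<in> {1..k}" "\<And>j. j \<in> {1..n i} \<Longrightarrow> w i j > 0" "(\<Sum>j=1..n i. w i j) = 1"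
    for i and w :: "nat \<Rightarrow> nat \<Rightarrow> real"
    using convex_sum[of "{1..n i}" I "w i" "x i"] \<open>convex I\<close> that x by (auto simp: less_imp_le)
  have xp_mem: "xp \<in> I" and xr_mem: "xr \<in> I"
    unfolding xp xr by (intro mean_mem row_mem p_pos r_pos p_sum r_sum; assumption)+

  have sum_P: "sum P J = 1" and sum_R: "sum R J = 1"
    unfolding P_def R_def J_def by (intro sum_product_weights p_sum r_sum; assumption)+
  have bary_P: "(\<Sum>j\<in>J. P j * X j) = xp" and bary_R: "(\<Sum>j\<in>J. R j * X j) = xr"
    unfolding P_def R_def J_def X_def xp xr
    by (intro product_weights_barycentre p_sum r_sum; assumption)+
  have JP: "jensen_functional k n f p q x = (\<Sum>j\<in>J. P j * f (X j)) - f xp"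
    and JR: "jensen_functional k n f r q x = (\<Sum>j\<in>J. R j * f (X j)) - f xr"
    unfolding jensen_functional_def P_def R_def J_def X_def xp xr by simp_all
  have diff: "(\<Sum>i=1..k. q i * (\<Sum>j=1..n i. (r i j - p i j) * x i j)) = xr - xp"
    unfolding xp xr by (simp add: sum_subtractf left_diff_distrib right_diff_distrib)

  have folded: "multi_indices k n = J" "(\<Prod>i=1..k. p i (j i)) = P j"
    "(\<Prod>i=1..k. r i (j i)) = R j" "(\<Sum>i=1..k. q i * x i (j i)) = X j" for j
    by (simp_all add: J_def P_def R_def X_def)
  have scaled: "(\<Sum>j\<in>J. (c * R j) * g j) = c * (\<Sum>j\<in>J. R j * g j)" for c and g :: "_ \<Rightarrow> real"
    by (simp add: sum_distrib_left mult.assoc)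
  have sum_scaled: "(\<Sum>j\<in>J. c * R j) = c" for c
    by (simp add: sum_distrib_left[symmetric] sum_R)
  have "m * f \<bar>xr - xp\<bar> + (\<Sum>j\<in>J. (P j - m * R j) * f \<bar>X j - xp\<bar>)
      \<le> ((\<Sum>j\<in>J. P j * f (X j)) - 1 * f xp) - ((\<Sum>j\<in>J. m * R j * f (X j)) - m * f xr)"
    using f X_mem m_le sum_P sum_scaled m_nonneg _ xp_mem _ xr_mem
    by (rule superquadratic_barycentre_comparison) (simp_all only: scaled bary_P bary_R mult_1)
  moreover have "1 * f \<bar>xp - xr\<bar> + (\<Sum>j\<in>J. (M * R j - P j) * f \<bar>X j - xr\<bar>)
      \<le> ((\<Sum>j\<in>J. M * R j * f (X j)) - M * f xr) - ((\<Sum>j\<in>J. P j * f (X j)) - 1 * f xp)"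
    using f X_mem le_M sum_scaled sum_P zero_le_one _ xr_mem _ xp_mem
    by (rule superquadratic_barycentre_comparison) (simp_all only: scaled bary_P bary_R mult_1)
  ultimately show ?thesis
    unfolding JP JR diff scaled folded by (simp add: abs_minus_commute right_diff_distrib)
qed

end
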